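(* According to relative worst order analysis, $\mathrm{WR}_{\mathrm{Nai},\mathrm{Maj}}=\frac n4$.
   Context: Online frequent items problem: an input sequence is $I=a_1,\ldots,a_n$ of items from an infinite universe, $n=|I|$. An algorithm maintains a buffer holding one item; $s_t$ is the buffer content after step $t$; at step $1$ the buffer receives $a_1$, and at each later step $t$ the algorithm either keeps $s_{t-1}$ or replaces it by $a_t$. With $f_I(a)=|\{i:a_i=a\}|/n$, the aggregate frequency of $\mathcal A$ on $I$ is $\mathcal A(I)=\sum_{t=1}^n f_I(s^{\mathcal A}_t)$ (to be maximized). Nai sets $s_t=a_t$ for all $t$. Maj keeps a counter, initially $0$: when an item arrives, if the counter is $0$ it buffers the item and sets the counter to $1$; otherwise, if the arriving item equals the buffered item the counter is incremented, else it is decremented (buffer unchanged). For an algorithm $\mathcal A$, $\mathcal A_W(I)=\min_\sigma\mathcal A(\sigma(I))$ over all permutations $\sigma(I)$ of $I$. Relative worst order analysis: for a total order $\sqsubseteq\in\{\le,\ge\}$, $f$ is an $(\mathcal A,\mathcal B,\sqsubseteq)$-function if there is $h\in o(f)$ such that for all $I$ (with $n=|I|$), $\mathcal A_W(I)\sqsubseteq (f(n)+h(n))\,\mathcal B_W(I)$. $f$ is a bounding function with respect to $(\mathcal A,\mathcal B,\sqsubseteq)$ if it is an $(\mathcal A,\mathcal B,\sqsubseteq)$-function and for every $(\mathcal A,\mathcal B,\sqsubseteq)$-function $g$, $\lim_{n\to\infty} f(n)/g(n)\sqsubseteq 1$. Let $f$ be a bounding function w.r.t. $(\mathcal A,\mathcal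 B,\le)$ and $g$ one w.r.t. $(\mathcal A,\mathcal B,\ge)$. $\mathcal A$ and $\mathcal B$ are comparable if $\lim f(n)\le 1$ or $\lim g(n)\ge1$. If $\lim f(n)\le1$, then $\mathcal B$ is better than $\mathcal A$ and $g$ is a relative worst order function of $\mathcal A$ and $\mathcal B$; if $\lim g(n)\ge 1$, then $\mathcal A$ is better than $\mathcal B$ and $f$ is a relative worst order function of $\mathcal A$ and $\mathcal B$. Functions $f,g$ are equivalent if $\lim f(n)/g(n)=1$; $\mathrm{WR}_{\mathcal A,\mathcal B}=f(n)$ means $f$ lies in the equivalence class of relative worst order functions of $\mathcal A$ and $\mathcal B$.
   Formalization: The functions f, g are required to be positive for n ≥ 1, and "lim ≤ 1" / "lim ≥ 1" are read as limsup ≤ 1 / liminf ≥ 1 (infinite values allowed), since with genuine limits or with negative functions no bounding functions would exist. *)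

theory Defs
  imports
    Complex_Main
    "HOL-Library.Landau_Symbols"
    "HOL-Library.Extended_Real"
    "HOL-Library.Liminf_Limsup"
    "HOL-Combinatorics.Multiset_Permutations"
begin

text \<open>
  A deterministic algorithm is given by its buffer content after having read a nonempty prefix
  \<open>a\<^sub>1, \<dots>, a\<^sub>t\<close> of the input, i.e. \<open>s\<^sub>t\<close> is \<open>A (take t I)\<close>; its value on the empty list is irrelevant.
\<close>
type_synonym 'a algorithm = "'a list \<Rightarrow> 'a"

definition online_algorithm :: "'a algorithm \<Rightarrow> bool" where
  "online_algorithm A \<longleftrightarrow>
     (\<forall>a. A [a] = a) \<and> (\<forall>p a. p \<noteq> [] \<longrightarrow> A (p @ [a]) = A p \<or> A (p @ [a]) = a)"

definition Nai :: "'a algorithm" where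
  "Nai p = last p"

fun maj_step :: "'a \<times> nat \<Rightarrow> 'a \<Rightarrow> 'a \<times> nat" where
  "maj_step (b, c) x =
     (if c = 0 then (x, 1) else if x = b then (b, c + 1) else (b, c - 1))"

text \<open>The initial buffer content is never inspected, since the counter starts at 0.\<close>
definition Maj :: "'a algorithm" where
  "Maj p = fst (foldl maj_step (undefined, 0) p)"

lemma online_algorithm_Nai: "online_algorithm Nai"
  by (simp add: online_algorithm_def Nai_def)

lemma online_algorithm_Maj: "online_algorithm Maj"
proof -
  have "fst (maj_step s x) = fst s \<or> fst (maj_step s x) = x" for s :: "'a \<times> nat" and x
    by (cases s) auto
  then show ?thesis
    by (auto simp: online_algorithm_def Maj_def)
qed

definition freq :: "'a list \<Rightarrow> 'a \<Rightarrow> real" where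
  "freq I a = real (count_list I a) / real (length I)"

definition aggregate :: "'a algorithm \<Rightarrow> 'a list \<Rightarrow> real" where
  "aggregate A I = (\<Sum>t = 1..length I. freq I (A (take t I)))"

definition worst_order :: "'a algorithm \<Rightarrow> 'a list \<Rightarrow> real" where
  "worst_order A I = Min (aggregate A ` permutations_of_multiset (mset I))"

datatype direction = Leq | Geq

fun rel :: "direction \<Rightarrow> real \<Rightarrow> real \<Rightarrow> bool" where
  "rel Leq x y \<longleftrightarrow> x \<le> y"
| "rel Geq x y \<longleftrightarrow> x \<ge> y"

text \<open>
  The condition \<open>lim u \<sqsubseteq> 1\<close>, for sequences that need not converge and with infinite limits
  allowed: every limit point of \<open>u\<close> in the extended reals is \<open>\<sqsubseteq> 1\<close>.
  Requiring convergence would leave no bounding functions at all, since the quotients in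
  \<open>bounding_function\<close> range over arbitrary, possibly oscillating, functions.
\<close>
fun lim_rel_one :: "direction \<Rightarrow> (nat \<Rightarrow> real) \<Rightarrow> bool" where
  "lim_rel_one Leq u \<longleftrightarrow> limsup (\<lambda>n. ereal (u n)) \<le> 1"
| "lim_rel_one Geq u \<longleftrightarrow> liminf (\<lambda>n. ereal (u n)) \<ge> 1"

text \<open>
  Functions are positive on the possible input lengths \<open>n \<ge> 1\<close>. With negative functions admitted
  (which satisfy the inequality for \<open>\<ge>\<close> trivially) the quotients below would be meaningless.
\<close>
definition comparison_function ::
    "'a algorithm \<Rightarrow> 'a algorithm \<Rightarrow> direction \<Rightarrow> (nat \<Rightarrow> real) \<Rightarrow> bool" where
  "comparison_function A B d f \<longleftrightarrow>
     (\<forall>n\<ge>1. f n > 0) \<and>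
     (\<exists>h. h \<in> o(f) \<and>
        (\<forall>I. I \<noteq> [] \<longrightarrow>
           rel d (worst_order A I) ((f (length I) + h (length I)) * worst_order B I)))"

definition bounding_function ::
    "'a algorithm \<Rightarrow> 'a algorithm \<Rightarrow> direction \<Rightarrow> (nat \<Rightarrow> real) \<Rightarrow> bool" where
  "bounding_function A B d f \<longleftrightarrow>
     comparison_function A B d f \<and>
     (\<forall>g. comparison_function A B d g \<longrightarrow> lim_rel_one d (\<lambda>n. f n / g n))"

text \<open>
  In the first disjunct \<open>B\<close> is better than \<open>A\<close>, in the second \<open>A\<close> is better than \<open>B\<close>;
  if neither is possible, the algorithms are incomparable and there is no such function.
\<close>
definition relative_worst_order_function ::
    "'a algorithm \<Rightarrow> 'a algorithm \<Rightarrow> (nat \<Rightarrow> real) \<Rightarrow> bool" where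
  "relative_worst_order_function A B w \<longleftrightarrow>
     (\<exists>f g. bounding_function A B Leq f \<and> bounding_function A B Geq g \<and>
        (lim_rel_one Leq f \<and> w = g \<or> lim_rel_one Geq g \<and> w = f))"

definition equivalent_functions :: "(nat \<Rightarrow> real) \<Rightarrow> (nat \<Rightarrow> real) \<Rightarrow> bool" where
  "equivalent_functions f g \<longleftrightarrow> (\<lambda>n. f n / g n) \<longlonglongrightarrow> 1"

text \<open>
  \<open>WR A B f\<close> renders \<open>WR\<^bsub>A,B\<^esub> = f(n)\<close>. The second conjunct expresses that \<open>f\<close> lies in
  the single equivalence class of relative worst order functions, the first that the class is
  nonempty, i.e. that the algorithms are comparable.
\<close>
definition WR :: "'a algorithm \<Rightarrow> 'a algorithm \<Rightarrow> (nat \<Rightarrow> real) \<Rightarrow> bool" where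
  "WR A B f \<longleftrightarrow>
     (\<exists>w. relative_worst_order_function A B w) \<and>
     (\<forall>w. relative_worst_order_function A B w \<longrightarrow> equivalent_functions f w)"

end

theory Submission
  imports Defs "HOL-Real_Asymp.Real_Asymp"
begin

text \<open>
  Write \<open>c x\<close> for the multiplicity of \<open>x\<close> in \<open>I\<close>, \<open>m\<close> for the largest multiplicity and \<open>T x\<close>
  for the number of steps during which Maj buffers \<open>x\<close>, so that \<open>n\<close> times the aggregate frequency
  is \<open>N = (\<Sum>x. c x * c x)\<close> for Nai and \<open>M = (\<Sum>x. T x * c x)\<close> for Maj. Each decrement of the
  counter of \<open>x\<close> is preceded by an increment caused by \<open>x\<close>; hence \<open>T x \<le> 2 * c x\<close>, and
  \<open>N - M / 2 = (\<Sum>x. c x * (c x - T x / 2)) \<le> m * (\<Sum>x. c x - T x / 2) = m * n / 2\<close>. Since also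
  \<open>2 * m \<le> M + 1\<close> and \<open>n \<le> M\<close>, this gives \<open>N \<le> (n / 4 + 3 / 4) * M\<close>, which is
  asymptotically attained when half of the items are equal and alternate with unique items.
  Conversely, no online algorithm beats Nai on its worst order, as sorting by multiplicity shows,
  so that the constant \<open>1\<close> is the lower bounding function.
\<close>

section \<open>Buffer contents over time\<close>

definition contents :: "'a algorithm \<Rightarrow> 'a list \<Rightarrow> 'a list" where
  "contents A p = map (\<lambda>t. A (take t p)) [1..<Suc (length p)]"

lemma length_contents [simp]: "length (contents A p) = length p"
  by (simp add: contents_def del: upt_Suc)

lemma contents_Nil [simp]: "contents A [] = []"
  by (simp add: contents_def)

lemma contents_snoc [simp]: "contents A (p @ [y]) = contents A p @ [A (p @ [y])]"
  unfolding contents_def by (simp add: upt_Suc_append del: upt_Suc)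

lemma contents_Nai [simp]: "contents Nai p = p"
  by (induction p rule: rev_induct) (simp_all add: Nai_def)

lemma online_algorithm_in_set:
  assumes "online_algorithm A" "p \<noteq> []"
  shows "A p \<in> set p"
  using assms(2)
proof (induction p rule: rev_induct)
  case (snoc y p)
  show ?case
  proof (cases "p = []")
    case True
    then show ?thesis using assms(1) by (simp add: online_algorithm_def)
  next
    case False
    then have "A (p @ [y]) = A p \<or> A (p @ [y]) = y"
      using assms(1) by (simp add: online_algorithm_def)
    with snoc False show ?thesis by auto
  qed
qed simp

lemma set_contents:
  assumes "online_algorithm A"
  shows "set (contents A p) \<subseteq> set p"
proof (induction p rule: rev_induct)
  case (snoc y p)
  then show ?case using online_algorithm_in_set[OF assms, of "p @ [y]"] by auto
qed simp

text \<open>The list of contents grows by one entry per item, so claims about all steps become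
  accessible to \<open>rev_induct\<close>, with natural numbers as weights.\<close>

lemma aggregate_eq_contents:
  "aggregate A I = real (\<Sum>x\<leftarrow>contents A I. count_list I x) / real (length I)"
proof -
  have "aggregate A I = sum_list (map (freq I) (contents A I))"
    unfolding aggregate_def contents_def
    by (simp add: interv_sum_list_conv_sum_set_nat atLeastLessThanSuc_atLeastAtMost o_def
        del: upt_Suc)
  also have "\<dots> = real (\<Sum>x\<leftarrow>contents A I. count_list I x) / real (length I)"
  proof -
    have "sum_list (map (freq I) xs) = real (\<Sum>x\<leftarrow>xs. count_list I x) / real (length I)" for xs
      by (induction xs) (simp_all add: freq_def add_divide_distrib)
    then show ?thesis .
  qed
  finally show ?thesis .
qed

section \<open>Worst orders\<close>

lemma count_list_mset_cong: "mset J = mset I \<Longrightarrow> count_list J x = count_list I x"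
  by (metis count_mset)

lemma worst_order_le:
  assumes "mset J = mset I"
  shows "worst_order A I \<le> aggregate A J"
  unfolding worst_order_def using assms
  by (intro Min_le) (auto simp: permutations_of_multisetI)

lemma worst_order_attained:
  obtains J where "mset J = mset I" "worst_order A I = aggregate A J"
proof -
  have "worst_order A I \<in> aggregate A ` permutations_of_multiset (mset I)"
    unfolding worst_order_def by (rule Min_in) auto
  then show thesis using that by (auto dest: permutations_of_multisetD)
qed

lemma aggregate_Nai_mset_cong:
  assumes "mset J = mset I"
  shows "aggregate Nai J = aggregate Nai I"
proof -
  have "(\<Sum>x\<leftarrow>J. count_list J x) = (\<Sum>x\<leftarrow>I. count_list I x)"
    using assms count_list_mset_cong[OF assms] by (simp flip: sum_mset_sum_list)
  then show ?thesis
    using mset_eq_length[OF assms] by (simp add: aggregate_eq_contents)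
qed

lemma worst_order_Nai: "worst_order Nai I = aggregate Nai I"
  by (metis worst_order_attained aggregate_Nai_mset_cong)

text \<open>
  In an order with increasing multiplicities, an online algorithm can only buffer items that are
  at most as frequent as the current one.
\<close>
lemma worst_order_le_Nai:
  assumes "online_algorithm A"
  shows "worst_order A I \<le> worst_order Nai I"
proof -
  define J where "J = sort_key (count_list I) I"
  have m: "mset J = mset I" by (simp add: J_def)
  have srt: "sorted (map (count_list J) J)"
  proof -
    have "count_list J = count_list I" using count_list_mset_cong[OF m] by blast
    then show ?thesis by (simp only:) (simp add: J_def)
  qed
  \<comment> \<open>The weight \<open>c\<close> is decoupled from \<open>p\<close>: multiplicities
    refer to all of \<open>J\<close> while the induction runs over prefixes.\<close>
  have "(\<Sum>x\<leftarrow>contents A p. c x) \<le> (\<Sum>x\<leftarrow>p. c x)" if "sorted (map c p)" for p and c :: "'a \<Rightarrow> nat"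
    using that
  proof (induction p rule: rev_induct)
    case (snoc y p)
    have "A (p @ [y]) \<in> set (p @ [y])"
      by (rule online_algorithm_in_set[OF assms]) simp
    with snoc.prems have "c (A (p @ [y])) \<le> c y"
      by (auto simp: sorted_append)
    with snoc show ?case by (simp add: sorted_append)
  qed simp
  from this[OF srt] have "aggregate A J \<le> aggregate Nai J"
    by (simp add: aggregate_eq_contents divide_right_mono)
  then show ?thesis
    using worst_order_le[OF m, of A] aggregate_Nai_mset_cong[OF m] by (simp add: worst_order_Nai)
qed

section \<open>Upper bound for Nai against Maj\<close>

lemma count_contents_Maj: "count_list (contents Maj p) x \<le> 2 * count_list p x"
proof -
  \<comment> \<open>The counter of the buffered item serves as potential: an arriving
    \<open>x\<close> adds at most 2 to both sides, while any other item arriving at a positive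
    counter of \<open>x\<close> trades one unit of counter for one step.\<close>
  have "count_list (contents Maj p) x +
      (let s = foldl maj_step (undefined, 0) p in if x = fst s then snd s else 0)
      \<le> 2 * count_list p x"
  proof (induction p rule: rev_induct)
    case (snoc y p)
    obtain b c where s: "foldl maj_step (undefined, 0) p = (b, c)" by force
    show ?case using snoc by (auto simp: s Maj_def Let_def split: if_splits)
  qed simp
  then show ?thesis by linarith
qed

lemma Nai_le_Maj:
  fixes I :: "'a list"
  assumes "I \<noteq> []"
  shows "aggregate Nai I \<le> (real (length I) / 4 + 3 / 4) * aggregate Maj I"
proof -
  define n where "n = real (length I)"
  define c where "c x = real (count_list I x)" for x
  define T where "T x = real (count_list (contents Maj I) x)" for x
  define M where "M = (\<Sum>x\<in>set I. T x * c x)"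
  define N where "N = (\<Sum>x\<in>set I. c x * c x)"
  have sub: "set (contents Maj I) \<subseteq> set I"
    by (rule set_contents[OF online_algorithm_Maj])
  have n0: "n > 0" using assms by (simp add: n_def)
  have aggM: "aggregate Maj I = M / n"
    unfolding aggregate_eq_contents M_def T_def c_def n_def
    by (subst sum_list_map_eq_sum_count2[OF sub]) simp_all
  have aggN: "aggregate Nai I = N / n"
    unfolding aggregate_eq_contents N_def c_def n_def contents_Nai
    by (subst sum_list_map_eq_sum_count) simp_all
  have c1: "c x \<ge> 1" if "x \<in> set I" for x
    using that count_list_0_iff[of I x] by (simp add: c_def)
  have T0: "T x \<ge> 0" for x by (simp add: T_def)
  have mult_ge_self: "T x \<le> T x * c x" if "x \<in> set I" for x
    using mult_left_mono[OF c1[OF that] T0, of x] by simp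
  have T2: "T x \<le> 2 * c x" for x
    using count_contents_Maj[of I x] unfolding T_def c_def by linarith
  have sumc: "(\<Sum>x\<in>set I. c x) = n"
    by (simp add: c_def n_def sum_count_set flip: of_nat_sum)
  have sumT: "(\<Sum>x\<in>set I. T x) = n"
    using sum_count_set[OF sub] by (simp add: T_def n_def flip: of_nat_sum)
  have "\<exists>a\<in>set I. \<forall>x\<in>set I. c x \<le> c a"
  proof -
    have "finite (c ` set I)" "c ` set I \<noteq> {}" using assms by auto
    from Max_in[OF this] Max_ge[OF this(1)] show ?thesis by (metis (no_types, lifting) imageE imageI)
  qed
  then obtain a where a: "a \<in> set I" "\<And>x. x \<in> set I \<Longrightarrow> c x \<le> c a" by blast
  have Mn: "n \<le> M"
    unfolding M_def sumT[symmetric] by (intro sum_mono mult_ge_self) auto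
  have Mm: "2 * c a - 1 \<le> M"
  proof (cases "2 * c a \<le> n")
    case True
    then show ?thesis using Mn by linarith
  next
    case False
    \<comment> \<open>A strict majority item cannot be kept out of the buffer: the others occupy it
      for at most \<open>2 * (n - c a) < n\<close> steps. By integrality, \<open>T a\<close> is at
      least 1.\<close>
    have "(\<Sum>x\<in>set I - {a}. T x) \<le> (\<Sum>x\<in>set I - {a}. 2 * c x)"
      using T2 by (intro sum_mono)
    then have "n - T a \<le> 2 * (n - c a)"
      using a(1) sumT sumc by (simp add: sum_diff1 flip: sum_distrib_left)
    then have "2 * c a - n \<le> T a" by simp
    with False have "T a > 0" by simp
    then have Ta: "T a \<ge> 1" by (simp add: T_def)
    have "(\<Sum>x\<in>set I - {a}. T x) \<le> (\<Sum>x\<in>set I - {a}. T x * c x)"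
      by (intro sum_mono mult_ge_self) auto
    then have "n - T a \<le> M - T a * c a"
      using a(1) sumT by (simp add: sum_diff1 M_def)
    \<comment> \<open>Expanded, this gives \<open>T a * c a \<ge> T a + c a - 1\<close>, hence
      \<open>M \<ge> n + c a - 1\<close>.\<close>
    moreover have "(T a - 1) * (c a - 1) \<ge> 0"
      using Ta c1[OF a(1)] by simp
    moreover have "c a \<le> n"
      unfolding c_def n_def using count_le_length[of I a] by simp
    ultimately show ?thesis by (simp add: algebra_simps)
  qed
  have "N - M / 2 = (\<Sum>x\<in>set I. c x * (c x - T x / 2))"
    by (simp add: N_def M_def sum_subtractf sum_divide_distrib algebra_simps)
  also have "\<dots> \<le> (\<Sum>x\<in>set I. c a * (c x - T x / 2))"
    using a(2) T2 by (intro sum_mono mult_right_mono) (auto simp: field_simps)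
  also have "\<dots> = c a * (n / 2)"
    by (simp add: sum_subtractf sumc sumT flip: sum_distrib_left sum_divide_distrib)
  also have "\<dots> \<le> (M + 1) / 2 * (n / 2)"
    using Mm n0 by (intro mult_right_mono) auto
  \<comment> \<open>The \<open>3 / 4\<close> collects \<open>M / 2\<close> from the left side and
    the leftover \<open>n / 4 \<le> M / 4\<close>.\<close>
  finally have "N \<le> (n / 4 + 3 / 4) * M"
    using Mn by (simp add: algebra_simps)
  then show ?thesis
    using n0 unfolding aggM aggN n_def[symmetric] by (simp add: divide_right_mono)
qed

lemma aggregate_ge_one:
  assumes "online_algorithm A" "I \<noteq> []"
  shows "aggregate A I \<ge> 1"
proof -
  have "(\<Sum>x\<leftarrow>contents A I. 1) \<le> (\<Sum>x\<leftarrow>contents A I. count_list I x)"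
  proof (rule sum_list_mono)
    fix x assume "x \<in> set (contents A I)"
    then have "x \<in> set I" using set_contents[OF assms(1)] by blast
    then show "1 \<le> count_list I x" using count_list_0_iff[of I x] by linarith
  qed
  then have "length I \<le> (\<Sum>x\<leftarrow>contents A I. count_list I x)"
    by (simp add: sum_list_triv)
  then show ?thesis
    using assms(2) unfolding aggregate_eq_contents by (simp add: le_divide_eq)
qed

text \<open>It suffices to compare on a worst order for Maj, since the value of Nai is the same on
  every order.\<close>

lemma worst_order_Nai_le_Maj:
  assumes "I \<noteq> []"
  shows "worst_order Nai I \<le> (real (length I) / 4 + 3 / 4) * worst_order Maj I"
proof -
  obtain J where J: "mset J = mset I" "worst_order Maj I = aggregate Maj J"
    by (rule worst_order_attained)
  from J(1) assms have "J \<noteq> []" by auto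
  from Nai_le_Maj[OF this] show ?thesis
    using J mset_eq_length[OF J(1)] aggregate_Nai_mset_cong[OF J(1)] by (simp add: worst_order_Nai)
qed

section \<open>Inputs witnessing tightness\<close>

text \<open>
  The order \<open>x\<^sub>1, a, x\<^sub>2, a, \<dots>\<close> with distinct \<open>x\<^sub>i\<close> resets the counter of Maj after each
  occurrence of \<open>a\<close>, so that \<open>a\<close> is never buffered.
\<close>
lemma alternating_input:
  fixes n :: nat
  assumes "infinite (UNIV :: 'a set)" "n > 0"
  obtains I :: "'a list" where "length I = n"
    "real n / 4 - 1 / 2 \<le> worst_order Nai I" "worst_order Maj I \<le> 1"
proof -
  obtain e :: "nat \<Rightarrow> 'a" where e: "inj e"
    using infinite_countable_subset[OF assms(1)] by blast
  \<comment> \<open>Here \<open>e 0\<close> is the repeated item; \<open>Suc i\<close> keeps the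
    unique items distinct from it.\<close>
  define f where "f i = (if even i then e (Suc i) else e 0)" for i
  define I where "I m = map f [0..<m]" for m
  have I_Suc: "I (Suc m) = I m @ [f m]" for m by (simp add: I_def)
  have len: "length (I m) = m" for m by (simp add: I_def)
  have count0: "count_list (I m) (e 0) = m div 2" for m
  proof (induction m)
    case (Suc m)
    then show ?case using injD[OF e, of "Suc m" 0] by (cases "even m") (auto simp: I_Suc f_def)
  qed (simp add: I_def)
  have count1: "count_list (I m) x \<le> 1" if "x \<noteq> e 0" for x m
  proof -
    have inj_f: "i = j" if "x = f i" "x = f j" for i j
      using that \<open>x \<noteq> e 0\<close> injD[OF e, of "Suc i" "Suc j"]
      by (simp add: f_def split: if_splits)
    have "card {i. i < length (I m) \<and> x = I m ! i} \<le> Suc 0"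
      using inj_f by (subst card_le_Suc0_iff_eq) (auto simp: I_def)
    then show ?thesis
      by (simp add: count_list_eq_length_filter length_filter_conv_card)
  qed
  \<comment> \<open>The case \<open>m = 0\<close> is exempt because \<open>undefined\<close> may
    equal \<open>e 0\<close>.\<close>
  have state: "snd (foldl maj_step (undefined, 0) (I m)) = m mod 2 \<and>
      (m > 0 \<longrightarrow> fst (foldl maj_step (undefined, 0) (I m)) \<noteq> e 0)" for m
  proof (induction m)
    case (Suc m)
    obtain b c where s: "foldl maj_step (undefined, 0) (I m) = (b, c)" by force
    show ?case using Suc injD[OF e, of "Suc m" 0]
      by (cases "even m") (auto simp: s I_Suc f_def even_iff_mod_2_eq_zero odd_iff_mod_2_eq_one mod_Suc)
  qed (simp add: I_def)
  have "(\<Sum>x\<leftarrow>contents Maj (I m). count_list (I n) x) \<le> m" for m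
  proof (induction m)
    case (Suc m)
    have "Maj (I (Suc m)) \<noteq> e 0" using state[of "Suc m"] by (simp add: Maj_def)
    with Suc count1[of "Maj (I (Suc m))" n] show ?case by (simp add: I_Suc)
  qed (simp add: I_def)
  from this[of n] have "aggregate Maj (I n) \<le> 1"
    unfolding aggregate_eq_contents len using assms(2) by (simp add: divide_le_eq)
  with worst_order_le[of "I n" "I n" Maj] have "worst_order Maj (I n) \<le> 1" by simp
  moreover have "real n / 4 - 1 / 2 \<le> worst_order Nai (I n)"
  proof -
    \<comment> \<open>Inserting \<open>e 0\<close> covers \<open>n = 1\<close>, where it does not
      occur in the input.\<close>
    have "(\<Sum>x\<leftarrow>I n. count_list (I n) x)
        = (\<Sum>x\<in>insert (e 0) (set (I n)). count_list (I n) x * count_list (I n) x)"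
      by (rule sum_list_map_eq_sum_count2) auto
    also have "\<dots> \<ge> count_list (I n) (e 0) * count_list (I n) (e 0)"
      by (rule member_le_sum) auto
    finally have *: "(n div 2) * (n div 2) \<le> (\<Sum>x\<leftarrow>I n. count_list (I n) x)"
      by (simp add: count0)
    define d where "d = n div 2"
    have "n \<le> 2 * d + 1" unfolding d_def by presburger
    then have "real n \<le> real (2 * d + 1)" by (rule of_nat_mono)
    then have k: "(real n - 1) / 2 \<le> real d" by simp
    \<comment> \<open>The two sides differ by exactly \<open>1 / 4\<close>.\<close>
    have "(real n / 4 - 1 / 2) * real n \<le> ((real n - 1) / 2) * ((real n - 1) / 2)"
      by (simp add: algebra_simps)
    also have "\<dots> \<le> real d * real d"
      using k assms(2) by (intro mult_mono) auto
    also have "\<dots> \<le> real (\<Sum>x\<leftarrow>I n. count_list (I n) x)"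
      using * unfolding d_def by (metis of_nat_le_iff of_nat_mult)
    finally show ?thesis
      unfolding worst_order_Nai aggregate_eq_contents len contents_Nai
      using assms(2) by (simp add: le_divide_eq)
  qed
  ultimately show thesis using that[of "I n"] len by blast
qed

text \<open>There is only one order and one item to buffer, so for every length some input makes all
  online algorithms equal.\<close>

lemma constant_input:
  fixes n :: nat
  assumes "n > 0" "online_algorithm A"
  shows "worst_order A (replicate n a) = real n"
proof -
  have c: "set (contents A (replicate n a)) \<subseteq> {a}"
    using set_contents[OF assms(2), of "replicate n a"] assms(1) by auto
  have "contents A (replicate n a) = replicate n a"
    by (rule replicate_eqI) (use c in auto)
  moreover have "count_list (replicate n a) a = n" by (induction n) auto
  ultimately have *: "aggregate A (replicate n a) = real n"
    using assms(1) by (simp add: aggregate_eq_contents sum_list_replicate)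
  obtain J where J: "mset J = mset (replicate n a)"
    "worst_order A (replicate n a) = aggregate A J"
    by (rule worst_order_attained)
  have "J = replicate n a"
  proof (rule replicate_eqI)
    show "length J = n" using mset_eq_length[OF J(1)] by simp
    show "y = a" if "y \<in> set J" for y
      using that mset_eq_setD[OF J(1)] by (auto split: if_splits)
  qed
  with J * show ?thesis by simp
qed

section \<open>Limit conditions\<close>

lemma smallo_imp_tendsto_one:
  fixes g h :: "nat \<Rightarrow> real"
  assumes "h \<in> o(g)" "\<And>n. n \<ge> 1 \<Longrightarrow> g n > 0"
  shows "(\<lambda>n. (g n + h n) / g n) \<longlonglongrightarrow> 1"
proof -
  have "(\<lambda>n. h n / g n) \<longlonglongrightarrow> 0" by (rule smalloD_tendsto[OF assms(1)])
  from tendsto_add[OF tendsto_const[of 1] this] have "(\<lambda>n. 1 + h n / g n) \<longlonglongrightarrow> 1" by simp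
  then show ?thesis
  proof (rule Lim_transform_eventually)
    show "\<forall>\<^sub>F n in sequentially. 1 + h n / g n = (g n + h n) / g n"
      using eventually_ge_at_top[of 1]
      by eventually_elim (use assms(2) in \<open>auto simp: add_divide_distrib less_imp_neq[symmetric]\<close>)
  qed
qed

lemma lim_rel_one_Leq_I:
  assumes "\<forall>\<^sub>F n in sequentially. u n \<le> v n" "v \<longlonglongrightarrow> 1"
  shows "lim_rel_one Leq u"
proof -
  have "limsup (\<lambda>n. ereal (u n)) \<le> limsup (\<lambda>n. ereal (v n))"
    using assms(1) by (intro Limsup_mono) simp
  also have "limsup (\<lambda>n. ereal (v n)) = 1"
    using assms(2) by (intro lim_imp_Limsup) (auto simp: one_ereal_def)
  finally show ?thesis by simp
qed

lemma lim_rel_one_Geq_I: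
  assumes "\<forall>\<^sub>F n in sequentially. v n \<le> u n" "v \<longlonglongrightarrow> 1"
  shows "lim_rel_one Geq u"
proof -
  have "1 = liminf (\<lambda>n. ereal (v n))"
    using assms(2) by (intro lim_imp_Liminf[symmetric]) (auto simp: one_ereal_def)
  also have "\<dots> \<le> liminf (\<lambda>n. ereal (u n))"
    using assms(1) by (intro Liminf_mono) simp
  finally show ?thesis by simp
qed

lemma lim_rel_one_Leq_D:
  assumes "lim_rel_one Leq u" "(e::real) > 1"
  shows "\<forall>\<^sub>F n in sequentially. u n < e"
proof -
  have "limsup (\<lambda>n. ereal (u n)) < ereal e"
    using assms by (auto simp: one_ereal_def intro: le_less_trans)
  then show ?thesis by (auto dest: Limsup_lessD)
qed

section \<open>The two bounding functions\<close>

lemma bounding_function_Geq_one: "bounding_function (Nai :: 'a algorithm) Maj Geq (\<lambda>n. 1)"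
  unfolding bounding_function_def
proof (intro conjI allI impI)
  show "comparison_function (Nai :: 'a algorithm) Maj Geq (\<lambda>n. 1)"
    unfolding comparison_function_def
    using worst_order_le_Nai[OF online_algorithm_Maj]
    by (intro conjI exI[of _ "\<lambda>_. 0"]) auto
next
  fix g assume "comparison_function (Nai :: 'a algorithm) Maj Geq g"
  then obtain h where g: "\<And>n. n \<ge> 1 \<Longrightarrow> g n > 0" and h: "h \<in> o(g)"
    and *: "\<And>I :: 'a list. I \<noteq> [] \<Longrightarrow>
      worst_order Nai I \<ge> (g (length I) + h (length I)) * worst_order Maj I"
    unfolding comparison_function_def by auto
  show "lim_rel_one Geq (\<lambda>n. 1 / g n)"
  proof (rule lim_rel_one_Geq_I[OF _ smallo_imp_tendsto_one[OF h g]])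
    show "\<forall>\<^sub>F n in sequentially. (g n + h n) / g n \<le> 1 / g n"
      using eventually_ge_at_top[of 1]
    proof eventually_elim
      case (elim n)
      have "(g n + h n) * real n \<le> real n"
        using *[of "replicate n undefined"] elim
        by (simp add: constant_input online_algorithm_Nai online_algorithm_Maj)
      then have "g n + h n \<le> 1" using elim by simp
      then show ?case using g[OF elim] by (simp add: divide_right_mono)
    qed
  qed
qed

lemma bounding_function_Leq_quarter:
  assumes "infinite (UNIV :: 'a set)"
  shows "bounding_function (Nai :: 'a algorithm) Maj Leq (\<lambda>n. real n / 4)"
  unfolding bounding_function_def
proof (intro conjI allI impI)
  have "(\<lambda>_. 3 / 4) \<in> o(\<lambda>n. real n / 4)"
    by real_asymp
  then show "comparison_function (Nai :: 'a algorithm) Maj Leq (\<lambda>n. real n / 4)"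
    unfolding comparison_function_def using worst_order_Nai_le_Maj
    by (intro conjI exI[of _ "\<lambda>_. 3 / 4"]) auto
next
  fix g assume "comparison_function (Nai :: 'a algorithm) Maj Leq g"
  then obtain h where g: "\<And>n. n \<ge> 1 \<Longrightarrow> g n > 0" and h: "h \<in> o(g)"
    and *: "\<And>I :: 'a list. I \<noteq> [] \<Longrightarrow>
      worst_order Nai I \<le> (g (length I) + h (length I)) * worst_order Maj I"
    unfolding comparison_function_def by auto
  \<comment> \<open>This factor compensates for the loss of \<open>1 / 2\<close> in the alternating
    input, where Nai is only known to reach \<open>(real n - 2) / 4\<close>.\<close>
  have "(\<lambda>n. real n / (real n - 2)) \<longlonglongrightarrow> 1" by real_asymp
  from tendsto_mult[OF smallo_imp_tendsto_one[OF h g] this]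
  have lim: "(\<lambda>n. (g n + h n) / g n * (real n / (real n - 2))) \<longlonglongrightarrow> 1" by simp
  show "lim_rel_one Leq (\<lambda>n. real n / 4 / g n)"
  proof (rule lim_rel_one_Leq_I[OF _ lim])
    show "\<forall>\<^sub>F n in sequentially. real n / 4 / g n \<le> (g n + h n) / g n * (real n / (real n - 2))"
      using eventually_ge_at_top[of 3]
    proof eventually_elim
      case (elim n)
      then have "n > 0" by simp
      from alternating_input[OF assms this] obtain I :: "'a list" where
        I: "length I = n" "real n / 4 - 1 / 2 \<le> worst_order Nai I" "worst_order Maj I \<le> 1" .
      from I(1) elim have "I \<noteq> []" by auto
      obtain J where J: "mset J = mset I" "worst_order Maj I = aggregate Maj J"
        by (rule worst_order_attained)
      \<comment> \<open>Equality, rather than the upper bound alone, lets the factor be dropped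
        without knowing the sign of \<open>g n + h n\<close>.\<close>
      with \<open>I \<noteq> []\<close> have "worst_order Maj I = 1"
        using aggregate_ge_one[OF online_algorithm_Maj, of J] I(3) by fastforce
      with *[OF \<open>I \<noteq> []\<close>] I have u: "(real n - 2) / 4 \<le> g n + h n" by (simp add: field_simps)
      have "real n / 4 = (real n - 2) / 4 * (real n / (real n - 2))"
        using elim by (simp add: field_simps)
      also have "\<dots> \<le> (g n + h n) * (real n / (real n - 2))"
        using u elim by (intro mult_right_mono) auto
      finally have "real n / 4 / g n \<le> (g n + h n) * (real n / (real n - 2)) / g n"
        using g[of n] elim by (intro divide_right_mono) auto
      then show ?case by (simp only: times_divide_eq_left)
    qed
  qed
qed

theorem theorem10:
  assumes "infinite (UNIV :: 'a set)"
  shows "WR (Nai :: 'a algorithm) (Maj :: 'a algorithm) (\<lambda>n. real n / 4)"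
proof -
  note quarter = bounding_function_Leq_quarter[OF assms]
  have "relative_worst_order_function (Nai :: 'a algorithm) Maj (\<lambda>n. real n / 4)"
    unfolding relative_worst_order_function_def
    using quarter bounding_function_Geq_one lim_rel_one_Geq_I[of "\<lambda>_. 1" "\<lambda>_. 1"] by fastforce
  moreover have "equivalent_functions (\<lambda>n. real n / 4) w"
    if "relative_worst_order_function (Nai :: 'a algorithm) Maj w" for w
  proof -
    from that obtain f g where fg: "bounding_function (Nai :: 'a algorithm) Maj Leq f"
      "lim_rel_one Leq f \<and> w = g \<or> lim_rel_one Geq g \<and> w = f"
      unfolding relative_worst_order_function_def by blast
    have f0: "f n > 0" if "n \<ge> 1" for n
      using fg(1) that by (auto simp: bounding_function_def comparison_function_def)
    \<comment> \<open>Any two bounding functions can be tested against each other, which bounds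
      their quotient from both sides in the limit.\<close>
    have 1: "lim_rel_one Leq (\<lambda>n. real n / 4 / f n)"
      using quarter fg(1) by (auto simp: bounding_function_def)
    have 2: "lim_rel_one Leq (\<lambda>n. f n / (real n / 4))"
      using quarter fg(1) by (auto simp: bounding_function_def)
    have "\<not> lim_rel_one Leq f"
    proof
      assume "lim_rel_one Leq f"
      then have "\<forall>\<^sub>F n in sequentially. f n < 2" by (rule lim_rel_one_Leq_D) simp
      moreover have "\<forall>\<^sub>F n in sequentially. real n / 4 / f n < 2"
        by (rule lim_rel_one_Leq_D[OF 1]) simp
      ultimately have "\<forall>\<^sub>F n::nat in sequentially. False"
        \<comment> \<open>The two bounds \<open>f n < 2\<close> and
          \<open>real n / 4 < 2 * f n\<close> would force \<open>n < 16\<close>.\<close>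
        using eventually_ge_at_top[of 16]
      proof eventually_elim
        case (elim n)
        then show False using f0[of n] by (simp add: divide_less_eq)
      qed
      then show False by simp
    qed
    with fg(2) have w: "w = f" by blast
    have "(\<lambda>n. real n / 4 / f n) \<longlonglongrightarrow> 1"
    proof (rule order_tendstoI)
      fix e :: real assume "e > 1"
      then show "\<forall>\<^sub>F n in sequentially. real n / 4 / f n < e" by (rule lim_rel_one_Leq_D[OF 1])
    next
      fix e :: real assume e: "e < 1"
      \<comment> \<open>As \<open>e\<close> may be nonpositive, it is raised to a positive value
        below 1 before inverting.\<close>
      define d where "d = max e (1 / 2)"
      have d: "d \<ge> e" "0 < d" "d < 1" using e by (auto simp: d_def)
      then have "\<forall>\<^sub>F n in sequentially. f n / (real n / 4) < 1 / d"
        by (intro lim_rel_one_Leq_D[OF 2]) simp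
      then show "\<forall>\<^sub>F n in sequentially. e < real n / 4 / f n"
        using eventually_ge_at_top[of 1]
      proof eventually_elim
        case (elim n)
        then have "d < real n / 4 / f n" using f0[of n] d by (simp add: field_simps)
        with d show ?case by linarith
      qed
    qed
    then show ?thesis by (simp add: w equivalent_functions_def)
  qed
  ultimately show ?thesis unfolding WR_def by blast
qed

end
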